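(* For any positive integers $a,b$, $$\frac{\vartheta_a\,\vartheta_b\,\vartheta_{a+b}}{\eta}=-\sum_{r,s\in\mathbb Z}\left(\frac s3\right)q^{r^2+rs+s^2/3}\,\zeta^{(a-b)r+as}.$$
   Context: $\eta(\tau)=q^{1/24}\prod_{n\ge1}(1-q^n)$, $\vartheta(\tau,z)=\sum_{r\in\mathbb Z}\left(\frac{-4}{r}\right)q^{r^2/8}\zeta^{r/2}$, $q=e^{2\pi i\tau}$, $\zeta=e^{2\pi iz}$, $\vartheta_a(\tau,z)=\vartheta(\tau,az)$; $\left(\frac s3\right)$ is the Legendre symbol modulo $3$ and $\left(\frac{-4}{r}\right)$ the Kronecker symbol (the nontrivial character modulo 4). *)

theory Defs
  imports "HOL-Analysis.Analysis" "HOL-Number_Theory.Number_Theory"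
begin

text \<open>
  \<open>nome_pow w x\<close> is the power $q^x$ of the nome $q = e^{2 \pi i w}$, for a real exponent \<open>x\<close>;
  fractional powers are thus fixed by the choice of \<open>w\<close> and not by a branch of the logarithm.
  With \<open>w = \<tau>\<close> it gives the powers of $q$, with \<open>w = z\<close> those of $\zeta$.
\<close>

definition nome_pow :: "complex \<Rightarrow> real \<Rightarrow> complex" where
  "nome_pow w x = exp (2 * of_real pi * \<i> * of_real x * w)"

text \<open>The Kronecker symbol $(-4/r)$, i.e. the nontrivial Dirichlet character modulo 4.\<close>

definition kronecker_minus4 :: "int \<Rightarrow> int" where
  "kronecker_minus4 r = (if r mod 4 = 1 then 1 else if r mod 4 = 3 then -1 else 0)"

text \<open>
  The functions below are meaningful for \<open>Im \<tau> > 0\<close>, where the product and the sum converge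
  absolutely. The library's infinite products start at index 0, hence the shift \<open>n + 1\<close>.
\<close>

definition dedekind_eta :: "complex \<Rightarrow> complex" where
  "dedekind_eta \<tau> = nome_pow \<tau> (1 / 24) * (\<Prod>n. 1 - nome_pow \<tau> 1 ^ (n + 1))"

definition jacobi_theta :: "complex \<Rightarrow> complex \<Rightarrow> complex" where
  "jacobi_theta \<tau> z =
     (\<Sum>\<^sub>\<infinity>r\<in>UNIV. of_int (kronecker_minus4 r)
        * nome_pow \<tau> ((of_int r)\<^sup>2 / 8) * nome_pow z (of_int r / 2))"

definition theta_mult :: "int \<Rightarrow> complex \<Rightarrow> complex \<Rightarrow> complex" where
  "theta_mult a \<tau> z = jacobi_theta \<tau> (of_int a * z)"

end

theory Submission
  imports Defs
begin

text \<open>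
  Multiplying out the three theta series and collecting the monomials in $e^{2 \pi i u}$ and
  $e^{2 \pi i v}$ (with $u = az$, $v = bz$) leaves one free summation index in each coefficient.
  Completing the square turns this inner sum into
  $\pm\sum_r \left(\frac{-4}{r}\right) q^{(3r - 2k)^2/24}$, where $k$ is the sum of the two exponents.
  A shift of $r$ reduces $k$ to $0$ or $\pm 1$: for $k = 0$ the series is odd and vanishes, and for
  $k = \pm 1$ it is $\pm\eta$ by Euler's pentagonal number theorem. Hence the factor
  $\left(\frac{k}{3}\right)\eta$.
\<close>

section \<open>The pentagonal number theorem\<close>

definition euler_prod :: "complex \<Rightarrow> nat \<Rightarrow> complex" where
  "euler_prod q n = (\<Prod>i<n. 1 - q ^ Suc i)"

lemma one_minus_power_nonzero:
  fixes q :: complex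
  assumes "norm q < 1"
  shows "1 - q ^ Suc n \<noteq> 0"
proof
  assume "1 - q ^ Suc n = 0"
  then have "norm q ^ Suc n = 1"
    by (metis norm_one norm_power right_minus_eq)
  moreover have "norm q ^ Suc n < 1"
    using assms power_decreasing[of 1 "Suc n" "norm q"] by simp
  ultimately show False by simp
qed

lemma euler_prod_nonzero: "norm q < 1 \<Longrightarrow> euler_prod q n \<noteq> 0"
  using one_minus_power_nonzero by (auto simp: euler_prod_def simp del: power_Suc)

lemma convergent_prod_euler:
  fixes q :: complex
  assumes "norm q < 1"
  shows "convergent_prod (\<lambda>i. 1 - q ^ Suc i)"
proof -
  have "summable (\<lambda>i. norm q * norm q ^ i)"
    using assms by (intro summable_mult summable_geometric) auto
  then show ?thesis
    by (intro abs_convergent_prod_imp_convergent_prod summable_imp_abs_convergent_prod)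
       (simp add: norm_mult norm_power)
qed

lemma euler_prod_tendsto:
  assumes "norm q < 1"
  shows "euler_prod q \<longlonglongrightarrow> (\<Prod>i. 1 - q ^ Suc i)"
  using convergent_prod_LIMSEQ[OF convergent_prod_euler[OF assms]]
  unfolding euler_prod_def by (simp add: LIMSEQ_lessThan_iff_atMost)

lemma prodinf_euler_nonzero:
  fixes q :: complex
  assumes "norm q < 1"
  shows "(\<Prod>i. 1 - q ^ Suc i) \<noteq> 0"
  using prodinf_nonzero[OF convergent_prod_euler[OF assms]] one_minus_power_nonzero[OF assms] by blast

text \<open>
  Shanks' finite form of the pentagonal number theorem: as \<open>n\<close> grows, only the term
  \<open>s = 0\<close>, which is \<open>euler_prod q n\<close>, survives.
\<close>

definition shanks_term :: "complex \<Rightarrow> nat \<Rightarrow> nat \<Rightarrow> complex" where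
  "shanks_term q n s =
     (- 1) ^ s * (euler_prod q n / euler_prod q s) * q ^ (s * n + s * (s + 1) div 2)"

section \<open>Shanks' finite identity\<close>

lemma triangular_Suc: "Suc s * (Suc s + 1) div 2 = s * (s + 1) div 2 + Suc s"
proof -
  have "Suc s * (Suc s + 1) = s * (s + 1) + Suc s * 2" by (simp add: algebra_simps)
  then show ?thesis by simp
qed

lemma shanks_term_Suc_left:
  "shanks_term q (Suc n) s = shanks_term q n s * q ^ s * (1 - q ^ Suc n)"
  by (simp add: shanks_term_def euler_prod_def power_add algebra_simps)

text \<open>The weight is \<open>1 - q ^ s * (1 - q ^ Suc n)\<close>, so by
  \<open>shanks_term_Suc_left\<close> each summand is what term s loses when n becomes n + 1. Split
  the weight into \<open>1 - q ^ s\<close> and \<open>q ^ (s + n + 1)\<close>: the first part of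
  summand s + 1 cancels the second part of summand s, so only the last second part survives.\<close>

lemma shanks_telescope:
  assumes "norm q < 1"
  shows "(\<Sum>s\<le>m. shanks_term q n s * (1 - q ^ s + q ^ (s + n + 1)))
           = shanks_term q n m * q ^ (m + n + 1)"
proof (induction m)
  case 0
  then show ?case by simp
next
  case (Suc m)
  define X where "X = shanks_term q n m"
  have ne: "1 - q ^ Suc m \<noteq> 0" "euler_prod q m \<noteq> 0"
    using one_minus_power_nonzero euler_prod_nonzero assms by blast+
  have e: "Suc m * n + Suc m * (Suc m + 1) div 2 = (m * n + m * (m + 1) div 2) + (n + Suc m)"
    unfolding triangular_Suc by simp
  \<comment> \<open>The cancellation: \<open>1 - q ^ Suc m\<close> is the last factor of the
    denominator \<open>euler_prod q (Suc m)\<close>, and the exponent of \<open>q\<close> grows by n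
    + m + 1.\<close>
  have "shanks_term q n (Suc m) * (1 - q ^ Suc m) = - X * q ^ (n + Suc m)"
  proof -
    define c where "c = 1 - q ^ Suc m"
    have "euler_prod q (Suc m) = euler_prod q m * c"
      by (simp add: euler_prod_def c_def)
    then show ?thesis
      unfolding shanks_term_def X_def e power_add[of q _ "n + Suc m"] c_def[symmetric]
      using ne[folded c_def] by simp
  qed
  with Suc show ?case unfolding X_def[symmetric]
    by (simp add: algebra_simps)
qed

text \<open>The generalized pentagonal numbers, typed as naturals to serve as exponents of
  \<open>q\<close>. Neither \<open>nat\<close> nor \<open>div\<close> truncates anything, since k (3
  k + 1) is nonnegative and even; \<open>two_times_pent\<close> records this.\<close>

definition pent :: "int \<Rightarrow> nat" where
  "pent k = nat (k * (3 * k + 1) div 2)"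

lemma pent_nonneg: "k * (3 * k + 1) \<ge> (0 :: int)"
proof (cases "k \<ge> 0")
  case True
  then show ?thesis by simp
next
  case False
  then show ?thesis by (intro mult_nonpos_nonpos) auto
qed

lemma two_times_pent: "2 * int (pent k) = k * (3 * k + 1)"
proof -
  have "even (k * (3 * k + 1))" by auto
  with pent_nonneg[of k] show ?thesis unfolding pent_def by auto
qed

text \<open>When n grows by one, the terms with s at most n lose the boundary term of
  \<open>shanks_telescope\<close>, and the diagonal term s = n + 1 is new. These two contributions
  are the summands of index -(n + 1) and n + 1 on the right.\<close>

theorem shanks_identity:
  assumes "norm q < 1"
  shows "(\<Sum>s\<le>n. shanks_term q n s) = (\<Sum>k\<in>{- int n..int n}. (- 1) ^ nat \<bar>k\<bar> * q ^ pent k)"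
proof (induction n)
  case 0
  then show ?case by (simp add: shanks_term_def euler_prod_def pent_def)
next
  case (Suc n)
  have ne: "euler_prod q n \<noteq> 0" for n
    using euler_prod_nonzero assms by blast
  \<comment> \<open>On the diagonal the quotient of Euler products is 1, which leaves a signed power
    of \<open>q\<close>.\<close>
  have diag: "shanks_term q n n = (- 1) ^ n * q ^ (n * n + n * (n + 1) div 2)" for n
    using ne by (simp add: shanks_term_def)
  have p1: "pent (int (Suc n)) = Suc n * Suc n + Suc n * (Suc n + 1) div 2"
  proof -
    have "2 * (Suc n * (Suc n + 1) div 2) = Suc n * (Suc n + 1)" by simp
    then have "2 * int (Suc n * (Suc n + 1) div 2) = int (Suc n * (Suc n + 1))" by presburger
    then have "2 * int (Suc n * Suc n + Suc n * (Suc n + 1) div 2) = 2 * int (pent (int (Suc n)))"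
      unfolding two_times_pent by (simp add: algebra_simps)
    then have "int (pent (int (Suc n))) = int (Suc n * Suc n + Suc n * (Suc n + 1) div 2)"
      by (simp only: mult_cancel_left) simp
    then show ?thesis by (simp only: of_nat_eq_iff)
  qed
  \<comment> \<open>The diagonal exponent for n plus the 2 n + 1 contributed by the telescoping
    boundary.\<close>
  have p2: "pent (- int (Suc n)) = n * n + n * (n + 1) div 2 + (n + n + 1)"
  proof -
    have "2 * (n * (n + 1) div 2) = n * (n + 1)" by simp
    then have "2 * int (n * (n + 1) div 2) = int (n * (n + 1))" by presburger
    then have "2 * int (n * n + n * (n + 1) div 2 + (n + n + 1)) = 2 * int (pent (- int (Suc n)))"
      unfolding two_times_pent by (simp add: algebra_simps)
    then have "int (pent (- int (Suc n))) = int (n * n + n * (n + 1) div 2 + (n + n + 1))"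
      by (simp only: mult_cancel_left) simp
    then show ?thesis by (simp only: of_nat_eq_iff)
  qed
  have "(\<Sum>s\<le>n. shanks_term q (Suc n) s) =
          (\<Sum>s\<le>n. shanks_term q n s - shanks_term q n s * (1 - q ^ s + q ^ (s + n + 1)))"
    by (intro sum.cong) (simp_all add: shanks_term_Suc_left power_add algebra_simps)
  also have "\<dots> = (\<Sum>s\<le>n. shanks_term q n s) - shanks_term q n n * q ^ (n + n + 1)"
    by (simp only: sum_subtractf shanks_telescope[OF assms])
  finally have "(\<Sum>s\<le>Suc n. shanks_term q (Suc n) s) = (\<Sum>s\<le>n. shanks_term q n s)
      - shanks_term q n n * q ^ (n + n + 1) + shanks_term q (Suc n) (Suc n)"
    by simp
  also have "\<dots> = (\<Sum>s\<le>n. shanks_term q n s)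
      + (- 1) ^ Suc n * q ^ pent (- int (Suc n)) + (- 1) ^ Suc n * q ^ pent (int (Suc n))"
    unfolding diag p1 p2 power_add[of _ _ "n + n + 1"] by simp
  also have "{- int (Suc n)..int (Suc n)}
      = insert (- int (Suc n)) (insert (int (Suc n)) {- int n..int n})"
    by auto
  then have "(\<Sum>s\<le>n. shanks_term q n s)
      + (- 1) ^ Suc n * q ^ pent (- int (Suc n)) + (- 1) ^ Suc n * q ^ pent (int (Suc n))
      = (\<Sum>k\<in>{- int (Suc n)..int (Suc n)}. (- 1) ^ nat \<bar>k\<bar> * q ^ pent k)"
    using Suc.IH by (simp add: nat_add_distrib algebra_simps)
  finally show ?case .
qed

text \<open>The Euler products and their reciprocals are bounded, so every term with s at least 1 is
  at most a constant times \<open>norm q ^ n\<close>, uniformly in s. There are n of them, and n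
  times \<open>norm q ^ n\<close> tends to 0.\<close>

lemma shanks_tendsto:
  assumes "norm q < 1"
  shows "(\<lambda>n. \<Sum>s\<le>n. shanks_term q n s) \<longlonglongrightarrow> (\<Prod>i. 1 - q ^ Suc i)"
proof -
  have lim: "euler_prod q \<longlonglongrightarrow> (\<Prod>i. 1 - q ^ Suc i)"
    by (rule euler_prod_tendsto[OF assms])
  obtain B where B: "\<And>n. norm (euler_prod q n) \<le> B"
    using convergent_imp_Bseq[OF convergentI[OF lim]] by (auto simp: Bseq_def)
  \<comment> \<open>The limit is nonzero, so the reciprocals converge too and are therefore
    bounded.\<close>
  have "(\<lambda>n. inverse (euler_prod q n)) \<longlonglongrightarrow> inverse (\<Prod>i. 1 - q ^ Suc i)"
    by (intro tendsto_inverse lim prodinf_euler_nonzero assms)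
  then obtain C where C: "\<And>n. norm (inverse (euler_prod q n)) \<le> C"
    using convergent_imp_Bseq[OF convergentI] by (force simp: Bseq_def)
  have BC: "0 \<le> B" "0 \<le> C"
    using B[of 0] C[of 0] norm_ge_zero order_trans by blast+
  have bound: "norm (shanks_term q n (Suc s)) \<le> B * C * norm q ^ n" for n s
  proof -
    have "norm (shanks_term q n (Suc s)) = norm (euler_prod q n) * norm (inverse (euler_prod q (Suc s)))
        * norm q ^ (Suc s * n + Suc s * (Suc s + 1) div 2)"
      by (simp add: shanks_term_def norm_mult norm_power divide_inverse del: power_Suc)
    also have "\<dots> \<le> B * C * norm q ^ n"
      using assms BC by (intro mult_mono B C power_decreasing) auto
    finally show ?thesis .
  qed
  have "(\<lambda>n. \<Sum>s<n. shanks_term q n (Suc s)) \<longlonglongrightarrow> 0"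
  proof (rule Lim_null_comparison)
    show "\<forall>\<^sub>F n in sequentially. norm (\<Sum>s<n. shanks_term q n (Suc s)) \<le> B * C * (real n * norm q ^ n)"
    proof (intro always_eventually allI)
      fix n
      have "norm (\<Sum>s<n. shanks_term q n (Suc s)) \<le> (\<Sum>s<n. B * C * norm q ^ n)"
        by (intro order_trans[OF norm_sum] sum_mono bound)
      then show "norm (\<Sum>s<n. shanks_term q n (Suc s)) \<le> B * C * (real n * norm q ^ n)"
        by (simp add: algebra_simps)
    qed
    show "(\<lambda>n. B * C * (real n * norm q ^ n)) \<longlonglongrightarrow> 0"
      using assms by (intro tendsto_mult_right_zero powser_times_n_limit_0) auto
  qed
  from tendsto_add[OF lim this]
  have "(\<lambda>n. euler_prod q n + (\<Sum>s<n. shanks_term q n (Suc s))) \<longlonglongrightarrow> (\<Prod>i. 1 - q ^ Suc i)"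
    by simp
  also have "(\<lambda>n. euler_prod q n + (\<Sum>s<n. shanks_term q n (Suc s))) = (\<lambda>n. \<Sum>s\<le>n. shanks_term q n s)"
    by (simp add: sum.atMost_shift shanks_term_def euler_prod_def)
  finally show ?thesis .
qed

text \<open>A \<open>has_sum\<close> is a limit along all finite sets of indices; this lets its
  value be read off from symmetric partial sums, the shape in which \<open>shanks_identity\<close>
  delivers them.\<close>

lemma symmetric_intervals_at_top:
  "filterlim (\<lambda>n. {- int n..int n}) (finite_subsets_at_top UNIV) sequentially"
  unfolding filterlim_finite_subsets_at_top
proof (intro allI impI)
  fix X :: "int set" assume "finite X \<and> X \<subseteq> UNIV"
  then have X: "finite X" by simp
  have "X \<subseteq> {- int n..int n}" if "n \<ge> nat (\<Sum>x\<in>X. \<bar>x\<bar>)" for n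
  proof
    fix x assume "x \<in> X"
    then have "\<bar>x\<bar> \<le> (\<Sum>x\<in>X. \<bar>x\<bar>)"
      using X by (intro member_le_sum) auto
    with that show "x \<in> {- int n..int n}" by auto
  qed
  then show "\<forall>\<^sub>F n in sequentially. finite {- int n..int n} \<and> X \<subseteq> {- int n..int n} \<and> {- int n..int n} \<subseteq> UNIV"
    by (auto simp: eventually_sequentially)
qed

section \<open>The pentagonal series over all integers\<close>

lemma summable_power_abs_int:
  fixes x :: real
  assumes "0 \<le> x" and "x < 1"
  shows "(\<lambda>r :: int. x ^ nat \<bar>r\<bar>) summable_on UNIV"
proof -
  have geo: "(\<lambda>n :: nat. x ^ n) summable_on UNIV"
    using assms by (intro norm_summable_imp_summable_on) (simp add: norm_power summable_geometric)
  have "(\<lambda>r :: int. x ^ nat \<bar>r\<bar>) summable_on range int"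
    by (subst summable_on_reindex) (use geo in \<open>auto simp: o_def\<close>)
  moreover have "(\<lambda>r :: int. x ^ nat \<bar>r\<bar>) summable_on range (\<lambda>n. - int n)"
    by (subst summable_on_reindex) (use geo in \<open>auto simp: o_def inj_def\<close>)
  moreover have "(UNIV :: int set) = range int \<union> range (\<lambda>n. - int n)"
    by (auto simp: image_iff) (metis int_cases2)
  ultimately show ?thesis
    using summable_on_union by metis
qed

lemma abs_le_pent: "nat \<bar>k\<bar> \<le> pent k"
proof -
  have "2 * \<bar>k\<bar> \<le> k * (3 * k + 1)"
  proof (cases "k \<ge> 0")
    case True
    then have "0 \<le> k * (3 * k - 1)"
      by (cases "k = 0") auto
    with True show ?thesis by (simp add: algebra_simps)
  next
    case False
    then have "0 \<le> k * (3 * k + 3)"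
      by (intro mult_nonpos_nonpos) auto
    with False show ?thesis by (simp add: algebra_simps)
  qed
  with two_times_pent[of k] show ?thesis by linarith
qed

text \<open>Domination by a geometric series, via \<open>abs_le_pent\<close>, gives some sum S. The
  symmetric partial sums tend to S and, being Shanks' sums, also to the product.\<close>

theorem pentagonal_number_theorem:
  fixes q :: complex
  assumes "norm q < 1"
  shows "((\<lambda>k. (- 1) ^ nat \<bar>k\<bar> * q ^ pent k) has_sum (\<Prod>i. 1 - q ^ Suc i)) UNIV"
proof -
  have "(\<lambda>k. norm ((- 1) ^ nat \<bar>k\<bar> * q ^ pent k)) summable_on UNIV"
  proof (rule Infinite_Sum.abs_summable_on_comparison_test')
    show "(\<lambda>k :: int. norm q ^ nat \<bar>k\<bar>) summable_on UNIV"
      using assms by (intro summable_power_abs_int) auto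
    show "norm ((- 1) ^ nat \<bar>k\<bar> * q ^ pent k) \<le> norm q ^ nat \<bar>k\<bar>" for k
      using assms power_decreasing[OF abs_le_pent, of "norm q" k]
      by (simp add: norm_mult norm_power)
  qed
  from abs_summable_summable[OF this]
  obtain S where S: "((\<lambda>k. (- 1) ^ nat \<bar>k\<bar> * q ^ pent k) has_sum S) UNIV"
    by (auto simp: summable_on_def)
  have "(\<lambda>n. \<Sum>k\<in>{- int n..int n}. (- 1) ^ nat \<bar>k\<bar> * q ^ pent k) \<longlonglongrightarrow> S"
    using filterlim_compose[OF S[unfolded has_sum_def] symmetric_intervals_at_top] .
  with shanks_tendsto[OF assms] have "S = (\<Prod>i. 1 - q ^ Suc i)"
    unfolding shanks_identity[OF assms] by (rule LIMSEQ_unique[symmetric])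
  with S show ?thesis by simp
qed

section \<open>Gaussian sums and unary theta series\<close>

text \<open>The quadratic term absorbs the linear one with a further -|r| to spare, so a multiple of
  exp (-|r|) is a majorant.\<close>

lemma summable_gaussian:
  fixes A B C :: real
  assumes "A > 0"
  shows "(\<lambda>r :: int. exp (- A * (real_of_int r)\<^sup>2 + B * real_of_int r + C)) summable_on UNIV"
proof -
  \<comment> \<open>The maximum of (|B| + 1) x - A x^2 over real x, plus C; the extra 1 is what
    leaves the decay exp (-|r|).\<close>
  define D where "D = (\<bar>B\<bar> + 1)\<^sup>2 / (4 * A) + C"
  have "(\<lambda>r :: int. exp D * exp (- real_of_int \<bar>r\<bar>)) summable_on UNIV"
  proof (rule summable_on_cmult_right)
    have "(\<lambda>r :: int. exp (- real_of_int \<bar>r\<bar>)) = (\<lambda>r. exp (- 1) ^ nat \<bar>r\<bar>)"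
      by (simp add: exp_of_nat_mult[symmetric])
    then show "(\<lambda>r :: int. exp (- real_of_int \<bar>r\<bar>)) summable_on UNIV"
      by (simp add: summable_power_abs_int)
  qed
  then have "(\<lambda>r :: int. norm (exp (- A * (real_of_int r)\<^sup>2 + B * real_of_int r + C))) summable_on UNIV"
  proof (rule Infinite_Sum.abs_summable_on_comparison_test')
    fix r :: int
    define x where "x = \<bar>real_of_int r\<bar>"
    have "B * real_of_int r \<le> \<bar>B\<bar> * x"
      by (metis abs_ge_self abs_mult x_def)
    moreover have "(\<bar>B\<bar> + 1) * x - A * x\<^sup>2 \<le> (\<bar>B\<bar> + 1)\<^sup>2 / (4 * A)"
    proof -
      have "0 \<le> (2 * A * x - (\<bar>B\<bar> + 1))\<^sup>2" by simp
      then show ?thesis using assms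
        by (simp add: field_simps power2_eq_square)
    qed
    moreover have "(real_of_int r)\<^sup>2 = x\<^sup>2" by (simp add: x_def)
    ultimately have "- A * (real_of_int r)\<^sup>2 + B * real_of_int r + C \<le> D + - x"
      unfolding D_def by (simp add: algebra_simps)
    then show "norm (exp (- A * (real_of_int r)\<^sup>2 + B * real_of_int r + C)) \<le> exp D * exp (- real_of_int \<bar>r\<bar>)"
      unfolding exp_add[symmetric] x_def by simp
  qed
  then show ?thesis by simp
qed

section \<open>Powers of the nome and the two characters\<close>

lemma nome_pow_add: "nome_pow w (x + y) = nome_pow w x * nome_pow w y"
  by (simp add: nome_pow_def exp_add[symmetric] algebra_simps)

lemma nome_pow_nat: "nome_pow w (real n) = nome_pow w 1 ^ n"
  by (simp add: nome_pow_def exp_of_nat_mult[symmetric] algebra_simps)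

lemma nome_pow_of_int_mult: "nome_pow (of_int a * w) x = nome_pow w (of_int a * x)"
  by (simp add: nome_pow_def algebra_simps)

lemma norm_nome_pow: "norm (nome_pow w x) = exp (- 2 * pi * x * Im w)"
  by (simp add: nome_pow_def)

lemma nome_pow_nonzero: "nome_pow w x \<noteq> 0"
  by (simp add: nome_pow_def)

lemma norm_nome_less_one: "Im \<tau> > 0 \<Longrightarrow> norm (nome_pow \<tau> 1) < 1"
  by (simp add: norm_nome_pow)

lemma dedekind_eta_nonzero:
  assumes "Im \<tau> > 0"
  shows "dedekind_eta \<tau> \<noteq> 0"
  using prodinf_euler_nonzero[OF norm_nome_less_one[OF assms]] nome_pow_nonzero
  by (simp add: dedekind_eta_def)

lemma kronecker_minus4_neg: "kronecker_minus4 (- r) = - kronecker_minus4 r"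
  unfolding kronecker_minus4_def by presburger

lemma kronecker_minus4_shift:
  "kronecker_minus4 (r + 2 * j) = (if even j then kronecker_minus4 r else - kronecker_minus4 r)"
  unfolding kronecker_minus4_def by presburger

lemma kronecker_minus4_even: "even r \<Longrightarrow> kronecker_minus4 r = 0"
  unfolding kronecker_minus4_def by presburger

lemma norm_kronecker_minus4_le: "norm (of_int (kronecker_minus4 r) :: complex) \<le> 1"
  by (simp add: kronecker_minus4_def)

lemma Legendre_3: "Legendre k 3 = (if k mod 3 = 0 then 0 else if k mod 3 = 1 then 1 else - 1)"
proof -
  have "k mod 3 = 0 \<or> k mod 3 = 1 \<or> k mod 3 = 2" by presburger
  moreover have "QuadRes 3 k" if "k mod 3 = 1"
    using that unfolding QuadRes_def cong_def by (intro exI[of _ 1]) simp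
  moreover have "\<not> QuadRes 3 k" if k2: "k mod 3 = 2"
  proof
    assume "QuadRes 3 k"
    then obtain y :: int where "y\<^sup>2 mod 3 = 2" using k2 by (auto simp: QuadRes_def cong_def)
    moreover have "y mod 3 = 0 \<or> y mod 3 = 1 \<or> y mod 3 = 2" by presburger
    ultimately show False
      using power_mod[of y 3 2] by auto
  qed
  ultimately show ?thesis by (auto simp: Legendre_def cong_def)
qed

text \<open>Stated for a general quadratic exponent to serve two purposes: A = 1/8 gives the theta
  series in w, and A = 3/8 with w = 0 the series for eta.\<close>

lemma summable_unary_theta:
  assumes "Im \<tau> > 0" and "A > 0"
  shows "(\<lambda>r. norm (of_int (kronecker_minus4 r) * nome_pow \<tau> (A * (of_int r)\<^sup>2 + B * of_int r + C)
            * nome_pow w (of_int r / 2))) summable_on UNIV"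
proof (rule Infinite_Sum.abs_summable_on_comparison_test')
  show "(\<lambda>r :: int. exp (- (2 * pi * A * Im \<tau>) * (real_of_int r)\<^sup>2
          + (- (2 * pi * B * Im \<tau>) - pi * Im w) * real_of_int r + (- (2 * pi * C * Im \<tau>)))) summable_on UNIV"
    using assms by (intro summable_gaussian) simp
next
  fix r :: int
  have "norm (of_int (kronecker_minus4 r) * nome_pow \<tau> (A * (of_int r)\<^sup>2 + B * of_int r + C)
            * nome_pow w (of_int r / 2))
       \<le> 1 * norm (nome_pow \<tau> (A * (of_int r)\<^sup>2 + B * of_int r + C)) * norm (nome_pow w (of_int r / 2))"
    unfolding norm_mult by (intro mult_right_mono norm_kronecker_minus4_le) auto
  also have "\<dots> = exp (- (2 * pi * A * Im \<tau>) * (real_of_int r)\<^sup>2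
          + (- (2 * pi * B * Im \<tau>) - pi * Im w) * real_of_int r + (- (2 * pi * C * Im \<tau>)))"
    by (simp add: norm_nome_pow exp_add[symmetric] algebra_simps)
  finally show "norm (of_int (kronecker_minus4 r) * nome_pow \<tau> (A * (of_int r)\<^sup>2 + B * of_int r + C)
            * nome_pow w (of_int r / 2)) \<le> \<dots>" .
qed

text \<open>Only odd r = 2 k + 1 contribute. There the character is (-1)^k and the exponent is (6 k
  + 1)^2 / 24 = 1/24 + k (3 k + 1) / 2, so this is the pentagonal series times the prefactor of
  eta.\<close>

lemma eta_series:
  assumes "Im \<tau> > 0"
  shows "((\<lambda>r. of_int (kronecker_minus4 r) * nome_pow \<tau> ((3 * of_int r - 2)\<^sup>2 / 24))
            has_sum dedekind_eta \<tau>) UNIV"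
proof -
  define f where "f r = of_int (kronecker_minus4 r) * nome_pow \<tau> ((3 * of_int r - 2)\<^sup>2 / 24)" for r
  define q where "q = nome_pow \<tau> 1"
  have q: "norm q < 1"
    using norm_nome_less_one[OF assms] by (simp add: q_def)
  have "(\<lambda>r. norm (f r)) summable_on UNIV"
    \<comment> \<open>The coefficients of (3 r - 2)^2 / 24; with w = 0 the last factor is 1.\<close>
    using summable_unary_theta[OF assms, of "3/8" "- 1/2" "1/6" 0]
    unfolding f_def by (simp add: nome_pow_def[of 0] power2_eq_square algebra_simps diff_divide_distrib add_divide_distrib)
  then have "f summable_on UNIV" by (rule abs_summable_summable)
  then obtain S where S: "(f has_sum S) UNIV" by (auto simp: summable_on_def)
  also have "?this \<longleftrightarrow> (f has_sum S) (range (\<lambda>k. 2 * k + 1))"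
  proof (rule has_sum_cong_neutral)
    fix r :: int assume "r \<in> UNIV - range (\<lambda>k. 2 * k + 1)"
    then have "even r" by (metis DiffE oddE rangeI)
    then show "f r = 0" by (simp add: f_def kronecker_minus4_even)
  qed auto
  also have "\<dots> \<longleftrightarrow> ((\<lambda>k. f (2 * k + 1)) has_sum S) UNIV"
    by (subst has_sum_reindex) (auto simp: o_def inj_def)
  also have "(\<lambda>k. f (2 * k + 1)) = (\<lambda>k. nome_pow \<tau> (1 / 24) * ((- 1) ^ nat \<bar>k\<bar> * q ^ pent k))"
  proof
    fix k :: int
    have "kronecker_minus4 (1 + 2 * k) = (if even k then 1 else - 1)"
      by (subst kronecker_minus4_shift) (simp add: kronecker_minus4_def)
    moreover have "(- 1 :: complex) ^ nat \<bar>k\<bar> = (if even k then 1 else - 1)"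
      by (auto simp: even_nat_iff)
    moreover have "(3 * real_of_int (1 + 2 * k) - 2)\<^sup>2 / 24 = 1 / 24 + real (pent k)"
    proof -
      have "real_of_int (2 * int (pent k)) = real_of_int (k * (3 * k + 1))"
        unfolding two_times_pent ..
      then show ?thesis by (simp add: power2_eq_square field_simps)
    qed
    ultimately show "f (2 * k + 1) = nome_pow \<tau> (1 / 24) * ((- 1) ^ nat \<bar>k\<bar> * q ^ pent k)"
      unfolding f_def q_def add.commute[of "2 * k" 1]
      by (simp only: nome_pow_add nome_pow_nat) simp
  qed
  finally have *: "((\<lambda>k. (- 1) ^ nat \<bar>k\<bar> * q ^ pent k) has_sum S / nome_pow \<tau> (1 / 24)) UNIV"
    by (subst (asm) has_sum_cmult_right_iff) (auto simp: nome_pow_nonzero)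
  from pentagonal_number_theorem[OF q] *
  have "S / nome_pow \<tau> (1 / 24) = (\<Prod>i. 1 - q ^ Suc i)"
    using has_sum_unique by blast
  then have "S = dedekind_eta \<tau>"
    using nome_pow_nonzero[of \<tau> "1/24"] by (simp add: dedekind_eta_def q_def field_simps)
  with S show ?thesis unfolding f_def by simp
qed

text \<open>The summand is invariant under (k, r) -> (k + 3, r + 2): 3 r - 2 k is unchanged, while
  the character and the sign attached to the parity of k both flip. So only k in {-1, 0, 1} matters,
  and r -> -r relates 1 to -1.\<close>

lemma eta_series_shifted:
  assumes "Im \<tau> > 0"
  shows "((\<lambda>r. of_int (if even k then kronecker_minus4 r else - kronecker_minus4 r)
              * nome_pow \<tau> ((3 * of_int r - 2 * of_int k)\<^sup>2 / 24))
            has_sum (- of_int (Legendre k 3) * dedekind_eta \<tau>)) UNIV"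
proof -
  define f where "f e r = of_int (kronecker_minus4 r) * nome_pow \<tau> ((3 * of_int r - 2 * of_int e)\<^sup>2 / 24)"
    for e r :: int
  have neg: "(f (- e) has_sum - S) UNIV" if "(f e has_sum S) UNIV" for e S
  proof -
    from that have "((\<lambda>r. - f e r) has_sum - S) UNIV" by (simp add: has_sum_uminus)
    also have "?this \<longleftrightarrow> ?thesis"
      by (rule has_sum_reindex_bij_witness[of _ uminus uminus])
         (auto simp: f_def kronecker_minus4_neg power2_eq_square algebra_simps)
    finally show ?thesis .
  qed
  have one: "(f 1 has_sum dedekind_eta \<tau>) UNIV"
    using eta_series[OF assms] by (simp add: f_def[abs_def])
  have zero: "(f 0 has_sum 0) UNIV"
  proof -
    have "(\<lambda>r. norm (f 0 r)) summable_on UNIV"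
      using summable_unary_theta[OF assms, of "3/8" 0 0 0]
      unfolding f_def by (simp add: nome_pow_def[of 0] power2_eq_square algebra_simps)
    then have "f 0 summable_on UNIV" by (rule abs_summable_summable)
    then obtain S where S: "(f 0 has_sum S) UNIV" by (auto simp: summable_on_def)
    \<comment> \<open>At e = 0 the reflection maps the series to itself with opposite sign.\<close>
    have "(f 0 has_sum - S) UNIV"
      using neg[OF S] by (simp only: minus_zero)
    with S have "S = - S"
      by (rule has_sum_unique)
    then have "S = 0"
      unfolding eq_neg_iff_add_eq_0 by simp
    with S show ?thesis by simp
  qed
  \<comment> \<open>The balanced residue e of k modulo 3 equals the Legendre symbol; for residue 2
    the quotient is therefore rounded up.\<close>
  obtain j e where k: "k = 3 * j + e" and e: "e = 0 \<or> e = 1 \<or> e = - 1" and leg: "Legendre k 3 = e"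
  proof -
    consider "k mod 3 = 0" | "k mod 3 = 1" | "k mod 3 = 2" by atomize_elim presburger
    then show ?thesis
    proof cases
      case 1
      then show ?thesis using that[of "k div 3" 0] by (auto simp: Legendre_3)
    next
      case 2
      then have "k = 3 * (k div 3) + 1" by presburger
      with 2 show ?thesis using that[of "k div 3" 1] by (simp add: Legendre_3)
    next
      case 3
      then have "k = 3 * (k div 3 + 1) + - 1" by presburger
      with 3 show ?thesis using that[of "k div 3 + 1" "- 1"] by (simp add: Legendre_3)
    qed
  qed
  have "(f e has_sum of_int e * dedekind_eta \<tau>) UNIV"
    using e zero one neg[OF one] by auto
  \<comment> \<open>For e = 1 and e = -1 the odd branch supplies the minus sign; for e = 0 the sum
    is zero anyway.\<close>
  then have "((\<lambda>r. if even e then f e r else - f e r)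
      has_sum (- of_int e * dedekind_eta \<tau>)) UNIV"
    using e by (auto simp: has_sum_uminus)
  also have "?this \<longleftrightarrow> ?thesis"
  proof (rule has_sum_reindex_bij_witness[of _ "\<lambda>r. r - 2 * j" "\<lambda>r. r + 2 * j"])
    fix r :: int
    have lin: "3 * real_of_int (r + 2 * j) - 2 * of_int k = 3 * of_int r - 2 * of_int e"
      unfolding k by simp
    have parity: "even k \<longleftrightarrow> (even j \<longleftrightarrow> even e)"
      unfolding k by simp
    show "of_int (if even k then kronecker_minus4 (r + 2 * j) else - kronecker_minus4 (r + 2 * j))
        * nome_pow \<tau> ((3 * of_int (r + 2 * j) - 2 * of_int k)\<^sup>2 / 24)
        = (if even e then f e r else - f e r)"
      unfolding f_def kronecker_minus4_shift lin parity by simp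
  qed (simp_all add: leg)
  finally show ?thesis .
qed

section \<open>The product of three theta functions\<close>

text \<open>Absolute convergence lets two series be multiplied over pairs of indices in any order.
  The first conclusion makes the lemma iterable, so that a third series can be multiplied
  on.\<close>

lemma has_sum_product:
  fixes f :: "'a \<Rightarrow> 'c::{real_normed_div_algebra, banach}" and g :: "'b \<Rightarrow> 'c"
  assumes f: "(\<lambda>x. norm (f x)) summable_on A" and g: "(\<lambda>y. norm (g y)) summable_on B"
  shows "(\<lambda>(x, y). norm (f x * g y)) summable_on A \<times> B"
    and "((\<lambda>(x, y). f x * g y) has_sum (infsum f A * infsum g B)) (A \<times> B)"
proof -
  have "(\<lambda>p. norm (case p of (x, y) \<Rightarrow> f x * g y)) summable_on A \<times> B"
    unfolding Infinite_Sum.abs_summable_on_Sigma_iff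
  proof (intro conjI ballI)
    show "(\<lambda>y. norm (case (x, y) of (x, y) \<Rightarrow> f x * g y)) summable_on B" for x
      using summable_on_cmult_right[OF g] by (simp add: norm_mult)
    show "(\<lambda>x. norm (\<Sum>\<^sub>\<infinity>y\<in>B. norm (case (x, y) of (x, y) \<Rightarrow> f x * g y))) summable_on A"
      using summable_on_cmult_left[OF f]
      by (simp add: norm_mult infsum_cmult_right' infsum_nonneg abs_mult)
  qed
  then show abs: "(\<lambda>(x, y). norm (f x * g y)) summable_on A \<times> B"
    by (simp add: case_prod_unfold)
  show "((\<lambda>(x, y). f x * g y) has_sum (infsum f A * infsum g B)) (A \<times> B)"
  proof (rule has_sum_SigmaI)
    show "((\<lambda>y. case (x, y) of (x, y) \<Rightarrow> f x * g y) has_sum f x * infsum g B) B" for x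
      using has_sum_cmult_right[OF has_sum_infsum[OF abs_summable_summable[OF g]]] by simp
    show "((\<lambda>x. f x * infsum g B) has_sum infsum f A * infsum g B) A"
      using has_sum_cmult_left[OF has_sum_infsum[OF abs_summable_summable[OF f]]] by simp
    show "(\<lambda>(x, y). f x * g y) summable_on A \<times> B"
      by (rule abs_summable_summable) (use abs in \<open>simp add: case_prod_unfold\<close>)
  qed
qed

section \<open>The triple series and its resummation\<close>

definition theta_term :: "complex \<Rightarrow> complex \<Rightarrow> int \<Rightarrow> complex" where
  "theta_term \<tau> w r = of_int (kronecker_minus4 r) * nome_pow \<tau> ((of_int r)\<^sup>2 / 8) * nome_pow w (of_int r / 2)"

text \<open>Ensures that the \<open>infsum\<close> in \<open>jacobi_theta\<close> is a genuine sum
  and not the default value 0.\<close>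

lemma abs_summable_theta_term:
  assumes "Im \<tau> > 0"
  shows "(\<lambda>r. norm (theta_term \<tau> w r)) summable_on UNIV"
  using summable_unary_theta[OF assms, of "1/8" 0 0 w] by (simp add: theta_term_def)

lemma triple_theta_has_sum:
  assumes "Im \<tau> > 0"
  shows "((\<lambda>((x, y), r). theta_term \<tau> u x * theta_term \<tau> v y * theta_term \<tau> w r)
           has_sum (jacobi_theta \<tau> u * jacobi_theta \<tau> v * jacobi_theta \<tau> w)) UNIV"
proof -
  note abs = abs_summable_theta_term[OF assms]
  have uv: "infsum (\<lambda>(x, y). theta_term \<tau> u x * theta_term \<tau> v y) UNIV = jacobi_theta \<tau> u * jacobi_theta \<tau> v"
    using infsumI[OF has_sum_product(2)[OF abs abs, of u v]]
    by (simp add: jacobi_theta_def theta_term_def[abs_def])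
  have "(\<lambda>p. norm (case p of (x, y) \<Rightarrow> theta_term \<tau> u x * theta_term \<tau> v y)) summable_on UNIV"
    using has_sum_product(1)[OF abs abs, of u v] by (simp add: case_prod_unfold)
  from has_sum_product(2)[OF this abs[of w]] show ?thesis
    unfolding uv by (simp add: jacobi_theta_def theta_term_def[abs_def] case_prod_unfold)
qed

text \<open>The substitution makes m and n the exponents belonging to u and v. The exponent of the
  nome is a quadratic polynomial in r, and completing the square splits off a part free of
  r.\<close>

lemma triple_theta_term:
  "theta_term \<tau> u (2 * m - r) * theta_term \<tau> v (2 * n - r) * theta_term \<tau> (u + v) r =
     nome_pow \<tau> ((of_int m)\<^sup>2 / 3 - of_int m * of_int n / 3 + (of_int n)\<^sup>2 / 3)
     * nome_pow u (of_int m) * nome_pow v (of_int n)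
     * (of_int (if even (m + n) then kronecker_minus4 r else - kronecker_minus4 r)
        * nome_pow \<tau> ((3 * of_int r - 2 * of_int (m + n))\<^sup>2 / 24))"
proof -
  have chi: "kronecker_minus4 (2 * l - r) = (if even l then - kronecker_minus4 r else kronecker_minus4 r)" for l
    using kronecker_minus4_shift[of "- r" l] by (simp add: kronecker_minus4_neg)
  \<comment> \<open>The reflections of r in the first two factors give two minus signs that cancel;
    what remains is the cube of a value in {-1, 0, 1}.\<close>
  have sq: "kronecker_minus4 r * kronecker_minus4 r * kronecker_minus4 r = kronecker_minus4 r"
    by (simp add: kronecker_minus4_def)
  have sign: "of_int (kronecker_minus4 (2 * m - r)) * of_int (kronecker_minus4 (2 * n - r)) * of_int (kronecker_minus4 r)
      = (of_int (if even (m + n) then kronecker_minus4 r else - kronecker_minus4 r) :: complex)"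
    unfolding of_int_mult[symmetric] of_int_eq_iff chi using sq by auto
  have expo: "(of_int (2 * m - r))\<^sup>2 / 8 + (of_int (2 * n - r))\<^sup>2 / 8 + (of_int r)\<^sup>2 / 8
      = ((of_int m)\<^sup>2 / 3 - of_int m * of_int n / 3 + (of_int n)\<^sup>2 / 3)
         + (3 * of_int r - 2 * of_int (m + n))\<^sup>2 / (24 :: real)"
    by (simp add: power2_eq_square field_simps)
  have tau: "nome_pow \<tau> ((of_int (2 * m - r))\<^sup>2 / 8) * nome_pow \<tau> ((of_int (2 * n - r))\<^sup>2 / 8) * nome_pow \<tau> ((of_int r)\<^sup>2 / 8)
     = nome_pow \<tau> ((of_int m)\<^sup>2 / 3 - of_int m * of_int n / 3 + (of_int n)\<^sup>2 / 3)
       * nome_pow \<tau> ((3 * of_int r - 2 * of_int (m + n))\<^sup>2 / 24)"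
    unfolding nome_pow_add[symmetric] expo ..
  have zeta: "nome_pow u (of_int (2 * m - r) / 2) * nome_pow v (of_int (2 * n - r) / 2) * nome_pow (u + v) (of_int r / 2)
     = nome_pow u (of_int m) * nome_pow v (of_int n)"
    unfolding nome_pow_def exp_add[symmetric]
    by (rule arg_cong[of _ _ exp]) (simp add: field_simps)
  have "theta_term \<tau> u (2 * m - r) * theta_term \<tau> v (2 * n - r) * theta_term \<tau> (u + v) r =
      (of_int (kronecker_minus4 (2 * m - r)) * of_int (kronecker_minus4 (2 * n - r)) * of_int (kronecker_minus4 r))
      * (nome_pow \<tau> ((of_int (2 * m - r))\<^sup>2 / 8) * nome_pow \<tau> ((of_int (2 * n - r))\<^sup>2 / 8) * nome_pow \<tau> ((of_int r)\<^sup>2 / 8))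
      * (nome_pow u (of_int (2 * m - r) / 2) * nome_pow v (of_int (2 * n - r) / 2) * nome_pow (u + v) (of_int r / 2))"
    unfolding theta_term_def by (simp only: mult_ac)
  then show ?thesis
    unfolding sign tau zeta by (simp only: mult_ac)
qed

text \<open>The identity for independent u and v, in coordinates symmetric in the two. It follows by
  summing over r first, with m and n fixed.\<close>

theorem triple_theta_expansion:
  assumes "Im \<tau> > 0"
  shows "((\<lambda>(m, n). of_int (Legendre (m + n) 3)
             * nome_pow \<tau> ((of_int m)\<^sup>2 / 3 - of_int m * of_int n / 3 + (of_int n)\<^sup>2 / 3)
             * nome_pow u (of_int m) * nome_pow v (of_int n))
           has_sum - (jacobi_theta \<tau> u * jacobi_theta \<tau> v * jacobi_theta \<tau> (u + v) / dedekind_eta \<tau>)) UNIV"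
proof -
  define f where "f = (\<lambda>((x, y), r). theta_term \<tau> u x * theta_term \<tau> v y * theta_term \<tau> (u + v) r)"
  define h where "h = (\<lambda>((m :: int, n :: int), r :: int). ((2 * m - r, 2 * n - r), r))"
  define E where "E m n = nome_pow \<tau> ((of_int m)\<^sup>2 / 3 - of_int m * of_int n / 3 + (of_int n)\<^sup>2 / 3)
     * nome_pow u (of_int m) * nome_pow v (of_int n)" for m n
  let ?T = "jacobi_theta \<tau> u * jacobi_theta \<tau> v * jacobi_theta \<tau> (u + v)"
  have "(f has_sum ?T) UNIV"
    unfolding f_def by (rule triple_theta_has_sum[OF assms])
  also have "?this \<longleftrightarrow> (f has_sum ?T) (range h)"
  \<comment> \<open>The range of \<open>h\<close> consists of the triples whose entries have equal
    parity. Any other triple has an even entry, where the character vanishes.\<close>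
  proof (rule has_sum_cong_neutral)
    fix p assume p: "p \<in> UNIV - range h"
    obtain x y r where xyr: "p = ((x, y), r)" by (metis surj_pair)
    have "odd (x + r) \<or> odd (y + r)"
    proof (rule ccontr)
      assume "\<not> ?thesis"
      then have "p = h ((((x + r) div 2), ((y + r) div 2)), r)"
        by (simp add: h_def xyr)
      with p show False by blast
    qed
    then have "even x \<or> even y \<or> even r" by auto
    then show "f p = 0"
      unfolding xyr f_def theta_term_def by (auto simp: kronecker_minus4_even)
  qed auto
  also have "\<dots> \<longleftrightarrow> ((f \<circ> h) has_sum ?T) (UNIV \<times> UNIV)"
    unfolding UNIV_Times_UNIV by (rule has_sum_reindex) (auto simp: inj_def h_def)
  \<comment> \<open>The family of triples is summable, so the sum may be taken fibrewise; the fibre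
    over (m, n) is the monomial \<open>E m n\<close> times the series of
    \<open>eta_series_shifted\<close> for k = m + n.\<close>
  finally have "((\<lambda>(m, n). E m n * (- of_int (Legendre (m + n) 3) * dedekind_eta \<tau>)) has_sum ?T) UNIV"
  proof (rule has_sum_SigmaD)
    fix p :: "int \<times> int"
    obtain m n where p: "p = (m, n)" by (metis surj_pair)
    show "((\<lambda>r. (f \<circ> h) (p, r)) has_sum
        (case p of (m, n) \<Rightarrow> E m n * (- of_int (Legendre (m + n) 3) * dedekind_eta \<tau>))) UNIV"
      using has_sum_cmult_right[OF eta_series_shifted[OF assms, of "m + n"], of "E m n"]
      by (simp add: p f_def h_def triple_theta_term E_def)
  qed
  also have "(\<lambda>(m, n). E m n * (- of_int (Legendre (m + n) 3) * dedekind_eta \<tau>))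
      = (\<lambda>p. - dedekind_eta \<tau> * (case p of (m, n) \<Rightarrow> of_int (Legendre (m + n) 3) * E m n))"
    by (auto simp: fun_eq_iff)
  finally show ?thesis
    using dedekind_eta_nonzero[OF assms]
    by (subst (asm) has_sum_cmult_right_iff) (auto simp: E_def mult.assoc case_prod_unfold)
qed

theorem theorem6p3:
  fixes a b :: int and \<tau> z :: complex
  assumes "a > 0" and "b > 0" and "Im \<tau> > 0"
  shows "let F = (\<lambda>(r :: int, s :: int). of_int (Legendre s 3)
             * nome_pow \<tau> ((of_int r)\<^sup>2 + of_int r * of_int s + (of_int s)\<^sup>2 / 3)
             * nome_pow z (of_int ((a - b) * r + a * s)))
         in F summable_on UNIV \<and>
            theta_mult a \<tau> z * theta_mult b \<tau> z * theta_mult (a + b) \<tau> z / dedekind_eta \<tau>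
              = - (\<Sum>\<^sub>\<infinity>(r, s)\<in>UNIV. F (r, s))"
proof -
  define F where "F = (\<lambda>(r :: int, s :: int). of_int (Legendre s 3)
             * nome_pow \<tau> ((of_int r)\<^sup>2 + of_int r * of_int s + (of_int s)\<^sup>2 / 3)
             * nome_pow z (of_int ((a - b) * r + a * s)))"
  define T where "T = theta_mult a \<tau> z * theta_mult b \<tau> z * theta_mult (a + b) \<tau> z / dedekind_eta \<tau>"
  have "((\<lambda>(m, n). of_int (Legendre (m + n) 3)
             * nome_pow \<tau> ((of_int m)\<^sup>2 / 3 - of_int m * of_int n / 3 + (of_int n)\<^sup>2 / 3)
             * nome_pow (of_int a * z) (of_int m) * nome_pow (of_int b * z) (of_int n)) has_sum - T) UNIV"
    using triple_theta_expansion[OF assms(3), of "of_int a * z" "of_int b * z"]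
    by (simp add: T_def theta_mult_def algebra_simps)
  also have "?this \<longleftrightarrow> (F has_sum - T) UNIV"
  \<comment> \<open>The unimodular change m = r + s, n = -r turns m + n into s, (m^2 - m n + n^2) /
    3 into r^2 + r s + s^2 / 3, and a m + b n into (a - b) r + a s.\<close>
  proof (rule has_sum_reindex_bij_witness[of _ "\<lambda>(r, s). (r + s, - r)" "\<lambda>(m, n). (- n, m + n)"])
    fix p :: "int \<times> int"
    obtain m n where p: "p = (m, n)" by (metis surj_pair)
    have tau: "(of_int (- n))\<^sup>2 + of_int (- n) * of_int (m + n) + (of_int (m + n))\<^sup>2 / 3
        = (of_int m)\<^sup>2 / 3 - of_int m * of_int n / 3 + (of_int n)\<^sup>2 / (3 :: real)"
      by (simp add: power2_eq_square field_simps)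
    have zeta: "(a - b) * - n + a * (m + n) = a * m + b * n"
      by (simp add: algebra_simps)
    show "F (case p of (m, n) \<Rightarrow> (- n, m + n)) = (case p of (m, n) \<Rightarrow> of_int (Legendre (m + n) 3)
             * nome_pow \<tau> ((of_int m)\<^sup>2 / 3 - of_int m * of_int n / 3 + (of_int n)\<^sup>2 / 3)
             * nome_pow (of_int a * z) (of_int m) * nome_pow (of_int b * z) (of_int n))"
      unfolding p F_def prod.case tau zeta
      by (simp add: nome_pow_of_int_mult nome_pow_add)
  qed auto
  finally have F: "(F has_sum - T) UNIV" .
  \<comment> \<open>One \<open>has_sum\<close> fact yields both the value and the summability, which
    excludes the default value 0 of \<open>infsum\<close>.\<close>
  from has_sum_imp_summable[OF F] infsumI[OF F]
  show ?thesis
    unfolding Let_def F_def[symmetric] T_def[symmetric] by simp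
qed

end
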